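(* Let $G$ be a connected graph of order $n$, minimum degree $\delta$ and vertex-connectivity $\kappa$, and let $k$ be an integer with $\delta\geq k\geq 3$. If $n\geq \frac12(\delta-k+2)(k^2-2k+7)$ and $\rho(G) \geq n-\delta+k-3$, then $\kappa\geq k$, unless $G\cong K_{k-1}\vee (K_{\delta-k+2}\cup K_{n-\delta-1})$.
   Context: All graphs are finite, simple and undirected. $\rho(G)$ denotes the spectral radius (largest eigenvalue) of the adjacency matrix of $G$. The vertex-connectivity $\kappa(G)$ of a connected non-complete graph is the minimum size of a vertex set whose removal disconnects $G$, and $\kappa(K_n)=n-1$. $K_r$ is the complete graph on $r$ vertices, $\cup$ is disjoint union and $G_1\vee G_2$ is the join (disjoint union plus all edges between $G_1$ and $G_2$). *)

theory Defs
  imports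
    "Jordan_Normal_Form.Spectral_Radius"
    "Graph_Theory.Graph_Theory"
begin

text \<open>
  Finite simple undirected graphs are the locale \<^locale>\<open>graph\<close>: finite, loop-free, symmetric
  digraphs without parallel arcs, so that an undirected edge is a pair of opposite arcs.
\<close>

subsection \<open>Degree, connectivity\<close>

text \<open>By symmetry the out-degree of a vertex is its number of neighbours.\<close>

definition min_degree :: "('a, 'b) pre_digraph \<Rightarrow> nat" where
  "min_degree G = Min (out_degree G ` verts G)"

text \<open>
  At least one vertex has to remain after the removal of a vertex cut: the null graph is not
  \<^const>\<open>Digraph_Component.connected\<close>, but deleting all vertices does not count as disconnecting.
\<close>

definition vertex_cut :: "('a, 'b) pre_digraph \<Rightarrow> 'a set \<Rightarrow> bool" where
  "vertex_cut G S \<longleftrightarrow>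
     S \<subset> verts G \<and> \<not> Digraph_Component.connected (G \<restriction> (verts G - S))"

definition vertex_connectivity :: "('a, 'b) pre_digraph \<Rightarrow> nat" where
  "vertex_connectivity G =
     (if complete_digraph (card (verts G)) G then card (verts G) - 1
      else Min {card S |S. vertex_cut G S})"

lemma (in graph) vertex_cut_exists:
  assumes "\<not> complete_digraph (card (verts G)) G"
  shows "\<exists>S. vertex_cut G S"
proof -
  from assms graph_axioms obtain u v
    where uv: "u \<in> verts G" "v \<in> verts G" "u \<noteq> v" "(u, v) \<notin> arcs_ends G"
    by (auto simp: complete_digraph_def arcs_ends_conv no_loops)
  from uv(4) sym_arcs have vu: "(v, u) \<notin> arcs_ends G"
    by (auto dest: arcs_ends_symmetric)
  let ?S = "verts G - {u, v}"
  let ?H = "G \<restriction> {u, v}"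
  have "verts G - ?S = {u, v}"
    using uv by auto
  moreover have "\<not> Digraph_Component.connected ?H"
  proof
    have no: "arcs ?H = {}"
      using uv vu by (auto simp: arcs_ends_conv dest: no_loops)
    assume "Digraph_Component.connected ?H"
    then have "u \<rightarrow>\<^sup>*\<^bsub>with_proj (mk_symmetric ?H)\<^esub> v"
      by (auto simp: Digraph_Component.connected_def strongly_connected_def mk_symmetric_def)
    then have "(u, v) \<in> (arcs_ends (with_proj (mk_symmetric ?H)))\<^sup>*"
      by (rule reachable_rtranclI)
    moreover have "arcs_ends (with_proj (mk_symmetric ?H)) = {}"
      using no by (simp add: mk_symmetric_def)
    ultimately show False
      using uv by simp
  qed
  moreover have "?S \<subset> verts G"
    using uv by auto
  ultimately have "vertex_cut G ?S"
    by (simp only: vertex_cut_def simp_thms)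
  then show ?thesis ..
qed

lemma (in graph) finite_vertex_cuts: "finite {card S |S. vertex_cut G S}"
proof -
  have "{card S |S. vertex_cut G S} \<subseteq> card ` Pow (verts G)"
    by (auto simp: vertex_cut_def)
  then show ?thesis
    by (rule finite_subset) simp
qed


subsection \<open>Spectral radius\<close>

definition adjacency_mat :: "('a, 'b) pre_digraph \<Rightarrow> 'a list \<Rightarrow> real mat" where
  "adjacency_mat G vs =
     mat (length vs) (length vs) (\<lambda>(i, j). if (vs ! i, vs ! j) \<in> arcs_ends G then 1 else 0)"

text \<open>
  The spectrum does not depend on the enumeration of the vertices, see
  \<open>spectrum_adjacency_mat_unique\<close> below, so an arbitrary one may be chosen.
\<close>

definition graph_spectral_radius :: "('a, 'b) pre_digraph \<Rightarrow> real" where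
  "graph_spectral_radius G =
     Max (spectrum (adjacency_mat G (SOME vs. distinct vs \<and> set vs = verts G)))"

lemma eigenvalue_adjacency_mat_iff:
  assumes vs: "distinct vs" "set vs = verts G"
  shows "eigenvalue (adjacency_mat G vs) x \<longleftrightarrow>
    (\<exists>f. (\<exists>u\<in>verts G. f u \<noteq> 0) \<and>
         (\<forall>u\<in>verts G. (\<Sum>v | v \<in> verts G \<and> (u, v) \<in> arcs_ends G. f v) = x * f u))"
proof -
  let ?n = "length vs"
  let ?A = "adjacency_mat G vs"
  have bij: "bij_betw ((!) vs) {0..<?n} (verts G)"
    using bij_betw_nth[OF vs(1) refl, of "verts G"] vs(2) by (simp add: atLeast0LessThan)
  have fin: "finite (verts G)"
    using vs(2) by (metis List.finite_set)
  have entry: "(?A *\<^sub>v w) $ i = (\<Sum>v | v \<in> verts G \<and> (vs ! i, v) \<in> arcs_ends G. f v)"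
    if i: "i < ?n" and w: "w \<in> carrier_vec ?n" "\<And>j. j < ?n \<Longrightarrow> w $ j = f (vs ! j)" for w f i
  proof -
    have "(?A *\<^sub>v w) $ i =
        (\<Sum>j = 0..<?n. if (vs ! i, vs ! j) \<in> arcs_ends G then f (vs ! j) else 0)"
      using i w by (auto simp: adjacency_mat_def scalar_prod_def intro!: sum.cong)
    also have "\<dots> = (\<Sum>v \<in> verts G. if (vs ! i, v) \<in> arcs_ends G then f v else 0)"
      by (rule sum.reindex_bij_betw[OF bij])
    also have "\<dots> = (\<Sum>v | v \<in> verts G \<and> (vs ! i, v) \<in> arcs_ends G. f v)"
      using fin by (rule sum.inter_filter[symmetric])
    finally show ?thesis .
  qed
  have dim: "dim_row ?A = ?n"
    by (simp add: adjacency_mat_def)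
  show ?thesis
  proof
    assume "eigenvalue ?A x"
    then obtain w where w: "w \<in> carrier_vec ?n" "w \<noteq> 0\<^sub>v ?n" "?A *\<^sub>v w = x \<cdot>\<^sub>v w"
      by (auto simp: eigenvalue_def eigenvector_def dim)
    define f where "f u = w $ (the_inv_into {0..<?n} ((!) vs) u)" for u
    have f: "w $ j = f (vs ! j)" if "j < ?n" for j
      using that bij by (simp add: f_def the_inv_into_f_f bij_betw_def)
    from w(1,2) obtain i where i: "i < ?n" "w $ i \<noteq> 0"
      by (metis carrier_vecD eq_vecI index_zero_vec(1) index_zero_vec(2))
    have "\<exists>u\<in>verts G. f u \<noteq> 0"
      using i f vs(2) nth_mem by metis
    moreover have "(\<Sum>v | v \<in> verts G \<and> (u, v) \<in> arcs_ends G. f v) = x * f u"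
      if "u \<in> verts G" for u
    proof -
      from that vs(2) obtain j where j: "j < ?n" "u = vs ! j"
        by (metis in_set_conv_nth)
      from entry[OF j(1) w(1) f] w(1,3) j f show ?thesis
        by simp
    qed
    ultimately show "\<exists>f. (\<exists>u\<in>verts G. f u \<noteq> 0) \<and>
         (\<forall>u\<in>verts G. (\<Sum>v | v \<in> verts G \<and> (u, v) \<in> arcs_ends G. f v) = x * f u)"
      by blast
  next
    assume "\<exists>f. (\<exists>u\<in>verts G. f u \<noteq> 0) \<and>
         (\<forall>u\<in>verts G. (\<Sum>v | v \<in> verts G \<and> (u, v) \<in> arcs_ends G. f v) = x * f u)"
    then obtain f u where f: "u \<in> verts G" "f u \<noteq> 0"
      "\<And>u. u \<in> verts G \<Longrightarrow> (\<Sum>v | v \<in> verts G \<and> (u, v) \<in> arcs_ends G. f v) = x * f u"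
      by blast
    define w where "w = vec ?n (\<lambda>j. f (vs ! j))"
    have w: "w \<in> carrier_vec ?n" "\<And>j. j < ?n \<Longrightarrow> w $ j = f (vs ! j)"
      by (auto simp: w_def)
    from f(1) vs(2) obtain i where i: "i < ?n" "u = vs ! i"
      by (metis in_set_conv_nth)
    have "w \<noteq> 0\<^sub>v ?n"
      using i f(2) w(2) by (metis index_zero_vec(1))
    moreover have "?A *\<^sub>v w = x \<cdot>\<^sub>v w"
    proof (rule eq_vecI)
      fix j assume "j < dim_vec (x \<cdot>\<^sub>v w)"
      then have j: "j < ?n"
        using w(1) by simp
      then have "vs ! j \<in> verts G"
        using vs(2) nth_mem by blast
      with entry[OF j w] f(3) w j show "(?A *\<^sub>v w) $ j = (x \<cdot>\<^sub>v w) $ j"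
        by simp
    qed (use w in \<open>simp add: dim\<close>)
    ultimately show "eigenvalue ?A x"
      using w(1) by (auto simp: eigenvalue_def eigenvector_def dim)
  qed
qed

lemma spectrum_adjacency_mat_unique:
  assumes "distinct vs" "set vs = verts G" "distinct ws" "set ws = verts G"
  shows "spectrum (adjacency_mat G vs) = spectrum (adjacency_mat G ws)"
  by (rule Set.set_eqI)
    (simp add: spectrum_def eigenvalue_adjacency_mat_iff[OF assms(1,2)]
      eigenvalue_adjacency_mat_iff[OF assms(3,4)])

lemma (in graph) graph_spectral_radius_eq:
  assumes "distinct vs" "set vs = verts G"
  shows "graph_spectral_radius G = Max (spectrum (adjacency_mat G vs))"
proof -
  from finite_distinct_list[OF finite_verts]
  have "\<exists>ws. distinct ws \<and> set ws = verts G"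
    by blast
  then have "distinct (SOME ws. distinct ws \<and> set ws = verts G) \<and>
      set (SOME ws. distinct ws \<and> set ws = verts G) = verts G"
    by (rule someI_ex)
  with assms show ?thesis
    by (metis graph_spectral_radius_def spectrum_adjacency_mat_unique)
qed


subsection \<open>Complete graphs, disjoint union and join\<close>

definition complete_graph :: "nat \<Rightarrow> nat pair_pre_digraph" where
  "complete_graph r =
     \<lparr> pverts = {..<r}, parcs = {(u, v). u < r \<and> v < r \<and> u \<noteq> v} \<rparr>"

definition disjoint_union ::
    "'a pair_pre_digraph \<Rightarrow> 'b pair_pre_digraph \<Rightarrow> ('a + 'b) pair_pre_digraph" where
  "disjoint_union G H =
     \<lparr> pverts = pverts G <+> pverts H,
       parcs = map_prod Inl Inl ` parcs G \<union> map_prod Inr Inr ` parcs H \<rparr>"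

definition graph_join ::
    "'a pair_pre_digraph \<Rightarrow> 'b pair_pre_digraph \<Rightarrow> ('a + 'b) pair_pre_digraph" where
  "graph_join G H =
     \<lparr> pverts = pverts (disjoint_union G H),
       parcs = parcs (disjoint_union G H)
         \<union> Inl ` pverts G \<times> Inr ` pverts H \<union> Inr ` pverts H \<times> Inl ` pverts G \<rparr>"

lemma complete_digraph_complete_graph: "complete_digraph r (with_proj (complete_graph r))"
  by (auto simp: complete_digraph_pair_def complete_graph_def)

lemma pair_graph_disjoint_union:
  assumes "pair_graph G" "pair_graph H"
  shows "pair_graph (disjoint_union G H)"
proof -
  interpret G: pair_graph G by fact
  interpret H: pair_graph H by fact
  have "sym (parcs G)" "sym (parcs H)"
    using G.pair_sym_arcs H.pair_sym_arcs by (auto simp: symmetric_def)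
  then show ?thesis
    by unfold_locales
      (auto simp: disjoint_union_def symmetric_def G.pair_finite_verts H.pair_finite_verts
        G.pair_finite_arcs H.pair_finite_arcs intro!: symI
        dest: symD G.in_arcsD1 G.in_arcsD2 H.in_arcsD1 H.in_arcsD2 G.pair_no_loops H.pair_no_loops)
qed

lemma pair_graph_graph_join:
  assumes "pair_graph G" "pair_graph H"
  shows "pair_graph (graph_join G H)"
proof -
  interpret G: pair_graph G by fact
  interpret H: pair_graph H by fact
  interpret U: pair_graph "disjoint_union G H"
    using assms by (rule pair_graph_disjoint_union)
  have "sym (parcs (disjoint_union G H))"
    using U.pair_sym_arcs by (auto simp: symmetric_def)
  then show ?thesis
    by unfold_locales
      (auto simp: graph_join_def symmetric_def G.pair_finite_verts H.pair_finite_verts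
        U.pair_finite_verts U.pair_finite_arcs intro!: symI
        dest: symD U.in_arcsD1 U.in_arcsD2 U.pair_no_loops,
       auto simp: disjoint_union_def)
qed

end

theory Submission
  imports Defs
begin

text \<open>
  A cut with fewer than \<open>k\<close> vertices can be enlarged to a set \<open>S\<close> with exactly \<open>k - 1\<close> vertices
  separating two sides \<open>A\<close> and \<open>B\<close> with \<open>m = \<delta> - k + 2 \<le> |A| \<le> |B|\<close>. Let \<open>N = n - m\<close>, so that the
  hypothesis reads \<open>\<rho>(G) \<ge> N - 1\<close>. If a positive vector \<open>x\<close> satisfies \<open>\<Sum>\<^bsub>v\<sim>u\<^esub> x(v) < (N - 1) x(u)\<close>
  at every vertex, then \<open>\<rho>(G) < N - 1\<close>. Such a vector exists if \<open>|A| > m\<close>: take it constant on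
  each of \<open>S\<close>, \<open>A\<close> and \<open>B\<close>. If \<open>|A| = m\<close>, the degree condition forces every vertex of \<open>A\<close> to be
  adjacent to all of \<open>S \<union> A\<close>; if moreover some edge \<open>pq\<close> inside \<open>S \<union> B\<close> is missing, such a vector
  is obtained from one that is constant on \<open>S\<close>, \<open>A\<close> and \<open>B\<close> by lowering the entries at \<open>p\<close> and
  \<open>q\<close>. Otherwise \<open>G\<close> is the exceptional graph.
\<close>

section \<open>Real eigenvalues of symmetric matrices and a test-vector bound for the spectral
  radius\<close>

text \<open>A complex eigenvector always exists. Symmetry forces its eigenvalue to be real, and then
  its real or its imaginary part is a real eigenvector. This makes the maximum in
  \<open>graph_spectral_radius\<close> a genuine eigenvalue.\<close>

lemma symmetric_real_spectrum_nonempty: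
  fixes A :: "real mat"
  assumes A: "A \<in> carrier_mat n n" and n: "0 < n"
    and sym: "\<And>i j. i < n \<Longrightarrow> j < n \<Longrightarrow> A $$ (i, j) = A $$ (j, i)"
  shows "spectrum A \<noteq> {}"
proof -
  let ?C = "map_mat complex_of_real A"
  have C: "?C \<in> carrier_mat n n" using A by simp
  from spectrum_non_empty[OF C n] obtain \<mu> v where
    v: "v \<in> carrier_vec n" "v \<noteq> 0\<^sub>v n" "?C *\<^sub>v v = \<mu> \<cdot>\<^sub>v v"
    using C by (auto simp: spectrum_def eigenvalue_def eigenvector_def)
  define r s where "r i = Re (v $ i)" and "s i = Im (v $ i)" for i
  have eq: "(\<Sum>j<n. of_real (A $$ (i, j)) * v $ j) = \<mu> * v $ i" if "i < n" for i
  proof -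
    have "(?C *\<^sub>v v) $ i = (\<Sum>j<n. of_real (A $$ (i, j)) * v $ j)"
      using that A v(1) by (auto simp: scalar_prod_def lessThan_atLeast0 intro!: sum.cong)
    then show ?thesis using v that by simp
  qed
  have re: "(\<Sum>j<n. A $$ (i, j) * r j) = Re \<mu> * r i - Im \<mu> * s i" if "i < n" for i
    using arg_cong[OF eq[OF that], of Re] by (simp add: r_def s_def)
  have im: "(\<Sum>j<n. A $$ (i, j) * s j) = Re \<mu> * s i + Im \<mu> * r i" if "i < n" for i
    using arg_cong[OF eq[OF that], of Im] by (simp add: r_def s_def)
  from v(1,2) obtain i0 where i0: "i0 < n" "v $ i0 \<noteq> 0"
    by (metis carrier_vecD eq_vecI index_zero_vec(1) index_zero_vec(2))
  \<comment> \<open>The bilinear form of A at s and r is evaluated in two ways; comparing them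
    leaves the imaginary part of \<mu> times the squared norm of v.\<close>
  have "(\<Sum>i<n. s i * (\<Sum>j<n. A $$ (i, j) * r j)) = (\<Sum>i<n. \<Sum>j<n. A $$ (i, j) * s i * r j)"
    by (simp add: sum_distrib_left mult_ac)
  also have "\<dots> = (\<Sum>j<n. \<Sum>i<n. A $$ (j, i) * s i * r j)"
    by (subst sum.swap) (auto intro!: sum.cong simp: sym)
  also have "\<dots> = (\<Sum>j<n. r j * (\<Sum>i<n. A $$ (j, i) * s i))"
    by (simp add: sum_distrib_left mult_ac)
  finally have "(\<Sum>i<n. s i * (Re \<mu> * r i - Im \<mu> * s i)) = (\<Sum>i<n. r i * (Re \<mu> * s i + Im \<mu> * r i))"
    by (simp add: re im)
  then have "(\<Sum>i<n. r i * (Re \<mu> * s i + Im \<mu> * r i) - s i * (Re \<mu> * r i - Im \<mu> * s i)) = 0"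
    by (simp add: sum_subtractf)
  then have "Im \<mu> * (\<Sum>i<n. (r i)\<^sup>2 + (s i)\<^sup>2) = 0"
    by (simp add: sum_distrib_left algebra_simps power2_eq_square)
  moreover have "(\<Sum>i<n. (r i)\<^sup>2 + (s i)\<^sup>2) > 0"
    using i0 by (intro sum_pos2[of _ i0]) (auto simp: r_def s_def complex_eq_iff sum_power2_gt_zero_iff)
  ultimately have [simp]: "Im \<mu> = 0" by simp
  have ev: "eigenvalue A (Re \<mu>)"
    if f: "\<And>i. i < n \<Longrightarrow> (\<Sum>j<n. A $$ (i, j) * f j) = Re \<mu> * f i" and f0: "f i0 \<noteq> 0" for f
    unfolding eigenvalue_def eigenvector_def
  proof (intro exI[of _ "vec n f"] conjI)
    show "vec n f \<noteq> 0\<^sub>v (dim_row A)"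
      using f0 i0 A by (metis carrier_matD(1) index_vec index_zero_vec(1))
    show "A *\<^sub>v vec n f = Re \<mu> \<cdot>\<^sub>v vec n f"
      using A f by (intro eq_vecI) (auto simp: scalar_prod_def lessThan_atLeast0)
  qed (use A in auto)
  have "r i0 \<noteq> 0 \<or> s i0 \<noteq> 0" using i0 by (auto simp: r_def s_def complex_eq_iff)
  then have "eigenvalue A (Re \<mu>)" using ev[of r] ev[of s] re im by auto
  then show ?thesis by (auto simp: spectrum_def)
qed

definition nbrs :: "('a, 'b) pre_digraph \<Rightarrow> 'a \<Rightarrow> 'a set" where
  "nbrs G u = {v \<in> verts G. (u, v) \<in> arcs_ends G}"

context graph
begin

lemma finite_nbrs [simp]: "finite (nbrs G u)"
  by (simp add: nbrs_def)

lemma nbrs_sym: "v \<in> nbrs G u \<Longrightarrow> u \<in> nbrs G v"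
  using graph_symmetric by (auto simp: nbrs_def intro: adj_in_verts)

lemma nbrs_irrefl: "u \<notin> nbrs G u"
  using adj_not_same by (auto simp: nbrs_def)

lemma nbrs_subset: "nbrs G u \<subseteq> verts G"
  by (auto simp: nbrs_def)

lemma arcs_ends_iff_nbrs: "(u, v) \<in> arcs_ends G \<longleftrightarrow> v \<in> nbrs G u"
  by (auto simp: nbrs_def intro: adj_in_verts)

text \<open>Without parallel arcs, \<open>head\<close> is injective on the arcs leaving u.\<close>

lemma out_degree_eq_card_nbrs: "out_degree G u = card (nbrs G u)"
proof -
  have "bij_betw (head G) (out_arcs G u) (nbrs G u)"
    unfolding bij_betw_def
  proof
    show "inj_on (head G) (out_arcs G u)"
      using no_multi_arcs by (auto simp: inj_on_def out_arcs_def arc_to_ends_def)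
    show "head G ` out_arcs G u = nbrs G u"
      by (auto simp: nbrs_def out_arcs_def arcs_ends_conv)
  qed
  then show ?thesis by (simp add: out_degree_def bij_betw_same_card)
qed

lemma min_degree_le_card_nbrs: "u \<in> verts G \<Longrightarrow> min_degree G \<le> card (nbrs G u)"
  by (simp add: min_degree_def flip: out_degree_eq_card_nbrs)

lemma spectral_radius_eigenfunction:
  assumes "verts G \<noteq> {}"
  obtains f where "\<exists>u\<in>verts G. f u \<noteq> 0"
    "\<And>u. u \<in> verts G \<Longrightarrow> (\<Sum>v\<in>nbrs G u. f v) = graph_spectral_radius G * f u"
proof -
  obtain vs where vs: "set vs = verts G" "distinct vs"
    using finite_distinct_list[OF finite_verts] by blast
  let ?A = "adjacency_mat G vs"
  have A: "?A \<in> carrier_mat (length vs) (length vs)" by (simp add: adjacency_mat_def)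
  have "spectrum ?A \<noteq> {}"
  proof (rule symmetric_real_spectrum_nonempty[OF A])
    show "0 < length vs" using vs assms by auto
    show "?A $$ (i, j) = ?A $$ (j, i)" if "i < length vs" "j < length vs" for i j
      using that graph_symmetric by (auto simp: adjacency_mat_def)
  qed
  with card_finite_spectrum[OF A] have "Max (spectrum ?A) \<in> spectrum ?A"
    by (intro Max_in) auto
  then have "eigenvalue ?A (graph_spectral_radius G)"
    using vs by (simp add: graph_spectral_radius_eq[of vs] spectrum_def)
  then show ?thesis
    using vs that by (auto simp: eigenvalue_adjacency_mat_iff nbrs_def)
qed

text \<open>A Collatz-Wielandt type bound: an eigenfunction f is compared with x at a vertex where
  the ratio |f| / x is largest.\<close>

lemma spectral_radius_less:
  fixes x :: "'a \<Rightarrow> real"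
  assumes ne: "verts G \<noteq> {}" and pos: "\<And>u. u \<in> verts G \<Longrightarrow> x u > 0"
    and less: "\<And>u. u \<in> verts G \<Longrightarrow> (\<Sum>v\<in>nbrs G u. x v) < c * x u"
  shows "graph_spectral_radius G < c"
proof -
  obtain f where f: "\<exists>u\<in>verts G. f u \<noteq> 0"
    "\<And>u. u \<in> verts G \<Longrightarrow> (\<Sum>v\<in>nbrs G u. f v) = graph_spectral_radius G * f u"
    using spectral_radius_eigenfunction[OF ne] by blast
  define M where "M = Max ((\<lambda>u. \<bar>f u\<bar> / x u) ` verts G)"
  have "M \<in> (\<lambda>u. \<bar>f u\<bar> / x u) ` verts G"
    unfolding M_def using ne by (intro Max_in) auto
  then obtain u where u: "u \<in> verts G" "M = \<bar>f u\<bar> / x u" by blast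
  have M: "\<bar>f v\<bar> \<le> M * x v" if "v \<in> verts G" for v
  proof -
    have "\<bar>f v\<bar> / x v \<le> M" unfolding M_def using that by (intro Max_ge) auto
    then show ?thesis using pos[OF that] by (simp add: field_simps)
  qed
  have Mpos: "M > 0"
  proof -
    obtain v where v: "v \<in> verts G" "f v \<noteq> 0" using f(1) by blast
    then have "0 < M * x v" using M[of v] by linarith
    then show ?thesis using pos[OF v(1)] by (simp add: zero_less_mult_iff)
  qed
  have fu: "\<bar>f u\<bar> = M * x u" using u pos[OF u(1)] by simp
  \<comment> \<open>Stated as an inequality, this holds whatever the sign of the eigenvalue.\<close>
  have "graph_spectral_radius G * \<bar>f u\<bar> \<le> \<bar>\<Sum>v\<in>nbrs G u. f v\<bar>"
    using f(2)[OF u(1)] by (simp add: abs_mult mult_right_mono)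
  also have "\<dots> \<le> (\<Sum>v\<in>nbrs G u. \<bar>f v\<bar>)" by (rule sum_abs)
  also have "\<dots> \<le> (\<Sum>v\<in>nbrs G u. M * x v)"
    using nbrs_subset M by (intro sum_mono) auto
  also have "\<dots> = M * (\<Sum>v\<in>nbrs G u. x v)" by (simp add: sum_distrib_left)
  also have "\<dots> < M * (c * x u)" using Mpos less[OF u(1)] by simp
  also have "\<dots> = c * \<bar>f u\<bar>" using fu by simp
  finally show ?thesis using fu Mpos pos[OF u(1)] by (simp add: mult_less_cancel_right)
qed

text \<open>Since x is positive, enlarging a neighbourhood to T only increases the sum. The bound
  can thus be checked on sets built from the sides of a separation, whose weights are known.\<close>

lemma spectral_radius_less_sum:
  fixes x :: "'a \<Rightarrow> real"
  assumes ne: "verts G \<noteq> {}" and pos: "\<And>u. u \<in> verts G \<Longrightarrow> x u > 0"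
    and sub: "\<And>u. u \<in> verts G \<Longrightarrow> \<exists>T. nbrs G u \<subseteq> T \<and> T \<subseteq> verts G \<and> sum x T < c * x u"
  shows "graph_spectral_radius G < c"
proof (rule spectral_radius_less[OF ne pos])
  fix u assume "u \<in> verts G"
  then obtain T where T: "nbrs G u \<subseteq> T" "T \<subseteq> verts G" "sum x T < c * x u" using sub by blast
  have "sum x (nbrs G u) \<le> sum x T"
    using T pos finite_subset[OF T(2)] by (intro sum_mono2) (auto intro: less_imp_le)
  then show "sum x (nbrs G u) < c * x u" using T(3) by simp
qed

end

section \<open>Numerical inequalities behind the choice of weights\<close>

text \<open>Here \<epsilon> is the total weight of the side A with m vertices. The lower bound on
  \<epsilon> is the inequality s + \<epsilon> < N * (\<epsilon> / m) at the vertices of A; the upper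
  bound ensures that lowering two entries outweighs the excess weight of S. The hypothesis on N
  leaves room between them.\<close>

lemma weights_exist_minimal_side:
  fixes s m N :: real
  assumes s: "s \<ge> 2" and m: "m \<ge> 2" and N: "N \<ge> m * (s\<^sup>2 + 4) / 2"
  obtains \<epsilon> where "0 < \<epsilon>" "\<epsilon> < 1" "m * s < \<epsilon> * (N - m)" "\<epsilon> * (s * (N + 1) + 2) < 2 * N"
proof -
  have s2: "s\<^sup>2 \<ge> 2 * s" using s by (simp add: power2_eq_square)
  have "m * (s\<^sup>2 + 4) \<ge> 2 * (s\<^sup>2 + 4)" using m by (intro mult_right_mono) auto
  then have N2: "N \<ge> s\<^sup>2 + 4" using N by (simp add: field_simps)
  have Npos: "N > 0" using N2 s2 s by linarith
  have "2 * (N - m) \<ge> m * (s\<^sup>2 + 2)" using N by (simp add: algebra_simps)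
  moreover have "m * (s\<^sup>2 + 2) > 0" using m s2 s by (intro mult_pos_pos) linarith+
  ultimately have "2 * (N - m) > 0" by (rule less_le_trans[rotated])
  then have Nm: "N - m > 0" by simp
  \<comment> \<open>Multiplied by m and combined with 2 * (N - m) \<ge> m * (s^2 + 2), this gives
    the cross-multiplied comparison of the two bounds on \<epsilon>.\<close>
  have "s * (s * (N + 1) + 2) < N * (s\<^sup>2 + 2)"
  proof -
    have "s\<^sup>2 + 2 * s < 2 * N" using N2 s2 s by linarith
    then show ?thesis by (simp add: algebra_simps power2_eq_square)
  qed
  then have "m * (s * (s * (N + 1) + 2)) < m * (N * (s\<^sup>2 + 2))" using m by simp
  also have "\<dots> = N * (m * (s\<^sup>2 + 2))" by simp
  also have "\<dots> \<le> N * (2 * (N - m))"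
    using \<open>2 * (N - m) \<ge> _\<close> Npos by (intro mult_left_mono) auto
  finally have key: "m * s * (s * (N + 1) + 2) < 2 * N * (N - m)" by (simp add: mult_ac)
  have D: "s * (N + 1) + 2 > 0" using s Npos by (simp add: add_pos_pos)
  have "m * s / (N - m) < 2 * N / (s * (N + 1) + 2)"
    using key Nm D by (simp add: field_simps)
  then obtain \<epsilon> where e: "m * s / (N - m) < \<epsilon>" "\<epsilon> < 2 * N / (s * (N + 1) + 2)"
    using dense by blast
  have e0: "0 < \<epsilon>" using e(1) m s Nm by (smt (verit) divide_pos_pos mult_pos_pos)
  have "s * (N + 1) \<ge> 2 * (N + 1)" using s Npos by (intro mult_right_mono) auto
  then have "2 * N / (s * (N + 1) + 2) < 1" using D by (simp add: field_simps)
  then have "\<epsilon> < 1" using e(2) by linarith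
  then show ?thesis using that[of \<epsilon>] e e0 Nm D by (simp add: field_simps)
qed

text \<open>With weight 1 on S, \<alpha> on A and \<beta> on B, the last three conditions are the
  inequalities at vertices of A, B and S. They are solvable once a * s / (N - a) + b * s / (N - b) <
  N - s.\<close>

lemma weights_exist_larger_side:
  fixes s m a b N :: real
  assumes s: "s \<ge> 2" and m: "m \<ge> 2" and a: "a \<ge> m + 1" and ab: "a \<le> b"
    and N: "N = a + b + s - m" "N \<ge> m * (s\<^sup>2 + 4) / 2"
  obtains \<alpha> \<beta> where "\<alpha> > 0" "\<beta> > 0" "s < (N - a) * \<alpha>" "s < (N - b) * \<beta>" "s + a * \<alpha> + b * \<beta> < N"
proof -
  define t where "t = a - m"
  have t: "t \<ge> 1" "a = m + t" "b = N - s - t" using a N by (auto simp: t_def)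
  have s2: "s\<^sup>2 \<ge> 2 * s" using s by (simp add: power2_eq_square)
  have f: "N - m - s\<^sup>2 \<ge> (m - 2) * s\<^sup>2 / 2 + m" using N(2) by (simp add: field_simps)
  have "(m - 2) * s\<^sup>2 / 2 \<ge> 0" using m by simp
  then have fm: "N - m - s\<^sup>2 \<ge> m" using f by linarith
  have Npos: "N > 0" using fm m s2 s by linarith
  \<comment> \<open>This is what fact \<open>2\<close> below requires after doubling and inserting 2
    * a \<le> N + m - s, the form that a \<le> b takes.\<close>
  have 1: "(m - s) * (s\<^sup>2 + s) < N * (N - m - s\<^sup>2)"
  proof (cases "m \<le> s")
    case True
    have "(m - s) * (s\<^sup>2 + s) \<le> 0" using True s by (simp add: mult_nonpos_nonneg)
    moreover have "N * (N - m - s\<^sup>2) > 0" using Npos fm m by (intro mult_pos_pos) auto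
    ultimately show ?thesis by linarith
  next
    case False
    have "2 * (s\<^sup>2 + s) \<le> (s\<^sup>2 + 4) * s"
    proof -
      have "0 \<le> s * ((s - 1)\<^sup>2 + 1)" using s by simp
      then show ?thesis by (simp add: power2_eq_square algebra_simps)
    qed
    then have "m * (2 * (s\<^sup>2 + s)) \<le> m * ((s\<^sup>2 + 4) * s)" using m by (intro mult_left_mono) auto
    have "(m - s) * (s\<^sup>2 + s) < m * (s\<^sup>2 + s)"
      using s s2 by (intro mult_strict_right_mono) linarith+
    also have "\<dots> \<le> m * (s\<^sup>2 + 4) / 2 * s"
      using \<open>m * (2 * (s\<^sup>2 + s)) \<le> _\<close> by (simp add: algebra_simps)
    also have "\<dots> \<le> N * (N - m - s\<^sup>2)"
      using N(2) fm False s Npos by (intro mult_mono) auto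
    finally show ?thesis .
  qed
  have "2 * a \<le> N + m - s" using ab N by linarith
  then have "2 * a * (N + s\<^sup>2 + s) \<le> (N + m - s) * (N + s\<^sup>2 + s)"
    using Npos s by (intro mult_right_mono) auto
  also have "\<dots> < 2 * (N * N)" using 1 by (simp add: algebra_simps power2_eq_square)
  finally have 2: "s * (s + 1) * a < N * (N - a)" by (simp add: algebra_simps power2_eq_square)
  have a0: "a > 0" using m a by linarith
  have Na: "N - a > 0" using N ab a s by linarith
  \<comment> \<open>As t \<ge> 1 gives s + t \<le> t * (s + 1), the inequality for general t follows
    from the case t = 1, which is fact \<open>2\<close>.\<close>
  have "s \<le> s * t" using t s by simp
  then have "s * (s + t) \<le> s * (t * (s + 1))"
    using s by (intro mult_left_mono) (simp_all add: algebra_simps)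
  then have "s * (s + t) * a \<le> s * (t * (s + 1)) * a" using a0 by (intro mult_right_mono) auto
  also have "\<dots> = t * (s * (s + 1) * a)" by simp
  also have "\<dots> < t * (N * (N - a))" using 2 t by simp
  finally have 3: "s * (s + t) * a < t * (N * (N - a))" .
  have st: "s + t > 0" using s t by linarith
  have "a * s / (N - a) < t * N / (s + t)" using 3 Na st by (simp add: field_simps)
  also have "t * N / (s + t) = N - s - b * s / (s + t)"
  proof -
    have "N = b + s + t" using t(3) by simp
    then show ?thesis using st by (simp add: field_simps)
  qed
  finally have gap: "a * s / (N - a) + b * s / (s + t) < N - s" by linarith
  define g where "g = N - s - (a * s / (N - a) + b * s / (s + t))"
  \<comment> \<open>Both weights are raised by \<eta> above their lower bounds, which uses up only
    half of the gap \<open>g\<close>.\<close>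
  define \<eta> where "\<eta> = g / (2 * (a + b))"
  have g: "g > 0" using gap by (simp add: g_def)
  have ab0: "a + b > 0" using a0 ab by linarith
  have eta: "\<eta> > 0" "(a + b) * \<eta> = g / 2" using g ab0 by (auto simp: \<eta>_def field_simps)
  have Nb: "N - b = s + t" using t by simp
  show ?thesis
  proof (rule that[of "s / (N - a) + \<eta>" "s / (s + t) + \<eta>"])
    show "s / (N - a) + \<eta> > 0" "s / (s + t) + \<eta> > 0"
      using s Na st eta by (auto intro!: add_pos_pos divide_pos_pos)
    show "s < (N - a) * (s / (N - a) + \<eta>)" "s < (N - b) * (s / (s + t) + \<eta>)"
      using Na st eta by (auto simp: distrib_left Nb)
    have "s + a * (s / (N - a) + \<eta>) + b * (s / (s + t) + \<eta>) =
        s + (a * s / (N - a) + b * s / (s + t)) + (a + b) * \<eta>"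
      by (simp add: algebra_simps)
    also have "\<dots> < N" using eta(2) g by (simp add: g_def)
    finally show "s + a * (s / (N - a) + \<eta>) + b * (s / (s + t) + \<eta>) < N" .
  qed
qed

section \<open>Spectral bounds for graphs with a separation\<close>

context graph
begin

text \<open>The test sets contain every vertex that the separation allows as a neighbour. Leaving
  out u itself turns the factor N of the weight inequalities into N - 1.\<close>

lemma spectral_radius_less_larger_side:
  fixes m :: real
  assumes V: "verts G = S \<union> A \<union> B" "S \<inter> A = {}" "S \<inter> B = {}" "A \<inter> B = {}"
    and sep: "\<And>u. u \<in> A \<Longrightarrow> nbrs G u \<inter> B = {}"
    and s: "card S \<ge> 2" and m: "m \<ge> 2" "real (card A) \<ge> m + 1" and ab: "card A \<le> card B"
    and N: "N = real (card (verts G)) - m" "N \<ge> m * ((real (card S))\<^sup>2 + 4) / 2"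
  shows "graph_spectral_radius G < N - 1"
proof -
  have fin: "finite S" "finite A" "finite B" using V(1) finite_verts by auto
  have c: "card (verts G) = card S + card A + card B"
    using V fin by (simp add: card_Un_disjoint Int_Un_distrib2)
  obtain \<alpha> \<beta> :: real where w: "\<alpha> > 0" "\<beta> > 0" "card S < (N - card A) * \<alpha>" "card S < (N - card B) * \<beta>"
    "card S + card A * \<alpha> + card B * \<beta> < N"
    by (rule weights_exist_larger_side[of "card S" m "card A" "card B" N]) (use s m ab N c in auto)
  define x where "x u = (if u \<in> S then 1 else if u \<in> A then \<alpha> else \<beta>)" for u
  have xS: "sum x S = card S" by (simp add: x_def)
  have xA: "sum x A = card A * \<alpha>"
    using V by (subst sum.cong[OF refl, of _ _ "\<lambda>_. \<alpha>"]) (auto simp: x_def)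
  have xB: "sum x B = card B * \<beta>"
    using V by (subst sum.cong[OF refl, of _ _ "\<lambda>_. \<beta>"]) (auto simp: x_def)
  have sep': "nbrs G u \<inter> A = {}" if "u \<in> B" for u
    using sep nbrs_sym[of _ u] that by blast
  show ?thesis
  proof (rule spectral_radius_less_sum[of x])
    show "verts G \<noteq> {}" using V s by auto
    show "x u > 0" for u using w by (simp add: x_def)
    fix u assume "u \<in> verts G"
    then consider (S) "u \<in> S" | (A) "u \<in> A" | (B) "u \<in> B" using V by blast
    then show "\<exists>T. nbrs G u \<subseteq> T \<and> T \<subseteq> verts G \<and> sum x T < (N - 1) * x u"
    proof cases
      case S
      have "sum x (verts G - {u}) = sum x (S \<union> A \<union> B) - 1"
        using S fin V(1) by (subst sum_diff1) (auto simp: x_def)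
      also have "sum x (S \<union> A \<union> B) = card S + card A * \<alpha> + card B * \<beta>"
        using V fin by (simp add: sum.union_disjoint Int_Un_distrib2 xS xA xB)
      finally have "sum x (verts G - {u}) < (N - 1) * x u"
        using w(5) S by (simp add: x_def)
      moreover have "nbrs G u \<subseteq> verts G - {u}"
        using nbrs_irrefl[of u] nbrs_subset[of u] by auto
      ultimately show ?thesis by (intro exI[of _ "verts G - {u}"]) auto
    next
      case A
      have "sum x (S \<union> A - {u}) = sum x (S \<union> A) - \<alpha>"
        using A V fin by (subst sum_diff1) (auto simp: x_def)
      also have "sum x (S \<union> A) = card S + card A * \<alpha>"
        using V fin by (simp add: sum.union_disjoint xS xA)
      finally have "sum x (S \<union> A - {u}) < (N - 1) * x u"
        using w(3) A V by (auto simp: x_def algebra_simps)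
      moreover have "nbrs G u \<subseteq> S \<union> A - {u}"
        using nbrs_irrefl[of u] nbrs_subset[of u] sep[OF A] V(1) by auto
      ultimately show ?thesis using V(1) by (intro exI[of _ "S \<union> A - {u}"]) auto
    next
      case B
      have "sum x (S \<union> B - {u}) = sum x (S \<union> B) - \<beta>"
        using B V fin by (subst sum_diff1) (auto simp: x_def)
      also have "sum x (S \<union> B) = card S + card B * \<beta>"
        using V fin by (simp add: sum.union_disjoint xS xB)
      finally have "sum x (S \<union> B - {u}) < (N - 1) * x u"
        using w(4) B V by (auto simp: x_def algebra_simps)
      moreover have "nbrs G u \<subseteq> S \<union> B - {u}"
        using nbrs_irrefl[of u] nbrs_subset[of u] sep'[OF B] V(1) by auto
      ultimately show ?thesis using V(1) by (intro exI[of _ "S \<union> B - {u}"]) auto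
    qed
  qed
qed

text \<open>Start with weights \<epsilon> / m on A, 1 on S and 1 - \<epsilon> / N on B. With u
  itself counted, vertices of S and of B lead to the same condition: the weight of S \<union> B is
  below N - \<epsilon>. The starting weights exceed N - \<epsilon> by |S| * \<epsilon> / N, and
  lowering the entries at p and q saves more than that. At p the lower entry is compensated by the
  absence of the neighbour q, and vice versa.\<close>

lemma spectral_radius_less_missing_edge:
  assumes V: "verts G = S \<union> A \<union> B" "S \<inter> A = {}" "S \<inter> B = {}" "A \<inter> B = {}"
    and sep: "\<And>u. u \<in> A \<Longrightarrow> nbrs G u \<inter> B = {}"
    and s: "card S \<ge> 2" and m: "card A = m" "m \<ge> 2"
    and N: "N = real (card S + card B)" "N \<ge> m * ((real (card S))\<^sup>2 + 4) / 2"
    and pq: "p \<in> S \<union> B" "q \<in> S \<union> B" "p \<noteq> q" "q \<notin> nbrs G p"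
  shows "graph_spectral_radius G < N - 1"
proof -
  have fin: "finite S" "finite A" "finite B" using V(1) finite_verts by auto
  obtain \<epsilon> :: real where e: "0 < \<epsilon>" "\<epsilon> < 1" "m * card S < \<epsilon> * (N - m)"
      "\<epsilon> * (card S * (N + 1) + 2) < 2 * N"
    by (rule weights_exist_minimal_side[of "card S" m N]) (use s m N in auto)
  have N0: "N \<ge> 2" using N(1) s by simp
  \<comment> \<open>This \<open>d\<close> makes the lowered weight \<open>1 - \<epsilon> / N - d\<close> equal to \<open>N * d\<close>. The larger it is, the smaller
    the total weight, but the inequality at \<open>p\<close> needs the weight at \<open>q\<close> to be at least \<open>N * d\<close>.\<close>
  define d where "d = (N - \<epsilon>) / (N * (N + 1))"
  have d0: "d > 0" using N0 e by (simp add: d_def)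
  have d1: "(N + 1) * d = 1 - \<epsilon> / N"
  proof -
    have "(N + 1) * d = (N - \<epsilon>) / N" using N0 by (simp add: d_def)
    then show ?thesis using N0 by (simp add: diff_divide_distrib)
  qed
  have Nd: "N * d > 0" using N0 d0 by simp
  define c where "c u = (if u \<in> S then 1 else 1 - \<epsilon> / N)" for u
  define x where "x u = (if u \<in> A then \<epsilon> / m else c u - (if u \<in> {p, q} then d else 0))" for u
  have c1: "c u \<le> 1" "c u \<ge> (N + 1) * d" for u
    using e N0 by (auto simp: c_def d1)
  have xpos: "x u > 0" for u
    using c1(2)[of u] Nd d0 e m by (auto simp: x_def algebra_simps)
  have xA: "sum x A = \<epsilon>"
    using m by (subst sum.cong[OF refl, of _ _ "\<lambda>_. \<epsilon> / m"]) (auto simp: x_def)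
  have xS: "sum x S \<le> card S"
  proof -
    have "x u \<le> 1" if "u \<in> S" for u
      using that V(2) c1(1)[of u] d0 by (auto simp: x_def)
    then have "sum x S \<le> (\<Sum>u\<in>S. 1)" by (rule sum_mono)
    then show ?thesis by simp
  qed
  have xW: "sum x (S \<union> B) < N - \<epsilon>"
  proof -
    have "sum x (S \<union> B) = (\<Sum>u\<in>S \<union> B. c u - (if u \<in> {p, q} then d else 0))"
      using V by (intro sum.cong) (auto simp: x_def)
    also have "\<dots> = sum c (S \<union> B) - (\<Sum>u\<in>{p, q}. d)"
      using fin pq sum.inter_restrict[of "S \<union> B" "\<lambda>_. d" "{p, q}"]
      by (simp add: sum_subtractf Int_absorb1 del: sum_constant)
    also have "\<dots> = sum c (S \<union> B) - 2 * d" using pq(3) by simp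
    also have "sum c (S \<union> B) = sum c S + sum c B" using V fin by (simp add: sum.union_disjoint)
    also have "sum c S = card S" by (simp add: c_def)
    also have "sum c B = card B * (1 - \<epsilon> / N)"
      using V by (subst sum.cong[OF refl, of _ _ "\<lambda>_. 1 - \<epsilon> / N"]) (auto simp: c_def)
    also have "real (card B) = N - card S" using N by simp
    also have "card S + (N - card S) * (1 - \<epsilon> / N) - 2 * d = N - \<epsilon> + (card S * \<epsilon> / N - 2 * d)"
      using N0 by (simp add: field_simps)
    also have "card S * \<epsilon> / N < 2 * d"
    proof -
      have "card S * \<epsilon> * (N + 1) < 2 * (N - \<epsilon>)" using e(4) by (simp add: algebra_simps)
      then have "card S * \<epsilon> < 2 * (N - \<epsilon>) / (N + 1)" using N0 by (simp add: field_simps)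
      then have "card S * \<epsilon> / N < 2 * (N - \<epsilon>) / (N + 1) / N"
        using N0 by (intro divide_strict_right_mono) auto
      then show ?thesis by (simp add: d_def mult_ac)
    qed
    finally show ?thesis by simp
  qed
  have qp: "p \<notin> nbrs G q" using pq(4) nbrs_sym[of p q] by blast
  show ?thesis
  proof (rule spectral_radius_less_sum[of x])
    show "verts G \<noteq> {}" using V s by auto
    show "x u > 0" for u by (rule xpos)
    fix u assume u: "u \<in> verts G"
    show "\<exists>T. nbrs G u \<subseteq> T \<and> T \<subseteq> verts G \<and> sum x T < (N - 1) * x u"
    proof (cases "u \<in> A")
      case True
      have "sum x (S \<union> A - {u}) = sum x S + sum x A - \<epsilon> / m"
        using True V fin by (subst sum_diff1) (auto simp: x_def sum.union_disjoint)
      moreover have "card S + \<epsilon> < N * (\<epsilon> / m)"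
        using e(3) m by (simp add: field_simps)
      moreover have "(N - 1) * x u = N * (\<epsilon> / m) - \<epsilon> / m"
        using True by (simp add: x_def left_diff_distrib diff_divide_distrib)
      ultimately have "sum x (S \<union> A - {u}) < (N - 1) * x u"
        using xS xA by linarith
      moreover have "nbrs G u \<subseteq> S \<union> A - {u}"
        using nbrs_irrefl[of u] nbrs_subset[of u] sep[OF True] V(1) by auto
      ultimately show ?thesis using V(1) by (intro exI[of _ "S \<union> A - {u}"]) auto
    next
      case False
      \<comment> \<open>\<open>X\<close> is the part of A that u may see; \<open>P\<close> collects
        vertices known not to be neighbours: u and, at an end of the missing edge, the other
        end.\<close>
      define X where "X = (if u \<in> S then A else {})"
      define P where "P = (if u \<in> {p, q} then {p, q} else {u})"
      have uW: "u \<in> S \<union> B" using False u V by blast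
      have P: "P \<subseteq> S \<union> B" "finite P" using pq uW by (auto simp: P_def)
      have XW: "X \<inter> (S \<union> B) = {}" "finite X" using V fin by (auto simp: X_def)
      have "sum x (X \<union> (S \<union> B) - P) = sum x X + sum x (S \<union> B) - sum x P"
        using P XW fin by (subst sum_diff) (auto simp: sum.union_disjoint)
      \<comment> \<open>One formula serves both cases by the choice of \<open>c\<close>: it equals
        \<epsilon> for u in S and 0 for u in B.\<close>
      also have "sum x X = N * c u - (N - \<epsilon>)"
        using N0 by (auto simp: X_def c_def xA algebra_simps)
      also have "N * c u - (N - \<epsilon>) + sum x (S \<union> B) - sum x P < N * c u - sum x P"
        using xW by simp
      also have "N * c u \<le> N * x u - x u + sum x P"
      proof (cases "u \<in> {p, q}")
        case True
        \<comment> \<open>The absent neighbour \<open>w\<close> has weight at least N * d, exactly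
          the amount by which lowering the entry at u reduces N * x u.\<close>
        define w where "w = (if u = p then q else p)"
        have w: "w \<in> {p, q}" "w \<notin> A" using pq V by (auto simp: w_def)
        have "sum x P = x u + x w" using True pq(3) by (auto simp: P_def w_def)
        moreover have "x w = c w - d" and xu: "x u = c u - d"
          using w True False by (auto simp: x_def)
        moreover have "N * c u = N * x u + N * d" by (simp add: xu algebra_simps)
        moreover have "N * d \<le> c w - d" using c1(2)[of w] by (simp add: algebra_simps)
        ultimately show ?thesis by linarith
      qed (use False in \<open>auto simp: P_def x_def\<close>)
      finally have "sum x (X \<union> (S \<union> B) - P) < (N - 1) * x u" by (simp add: algebra_simps)
      moreover have "nbrs G u \<subseteq> X \<union> (S \<union> B) - P"
      proof -
        have "nbrs G u \<inter> A = {}" if "u \<in> B" using sep nbrs_sym[of _ u] that by blast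
        then have "nbrs G u \<subseteq> X \<union> (S \<union> B)"
          using nbrs_subset[of u] V uW by (auto simp: X_def)
        moreover have "nbrs G u \<inter> P = {}"
          using pq(4) qp nbrs_irrefl[of u] by (auto simp: P_def)
        ultimately show ?thesis by auto
      qed
      moreover have "X \<union> (S \<union> B) - P \<subseteq> verts G" using V(1) by (auto simp: X_def)
      ultimately show ?thesis by (intro exI[of _ "X \<union> (S \<union> B) - P"]) auto
    qed
  qed
qed

end

section \<open>Arcs of disjoint unions, joins and complete graphs\<close>

lemma disjoint_union_simps [simp]:
  "pverts (disjoint_union G H) = pverts G <+> pverts H"
  "(Inl a, Inl a') \<in> parcs (disjoint_union G H) \<longleftrightarrow> (a, a') \<in> parcs G"
  "(Inr b, Inr b') \<in> parcs (disjoint_union G H) \<longleftrightarrow> (b, b') \<in> parcs H"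
  "(Inl a, Inr b) \<notin> parcs (disjoint_union G H)"
  "(Inr b, Inl a) \<notin> parcs (disjoint_union G H)"
  by (auto simp: disjoint_union_def)

lemma graph_join_simps [simp]:
  "pverts (graph_join G H) = pverts G <+> pverts H"
  "(Inl a, Inl a') \<in> parcs (graph_join G H) \<longleftrightarrow> (a, a') \<in> parcs G"
  "(Inr b, Inr b') \<in> parcs (graph_join G H) \<longleftrightarrow> (b, b') \<in> parcs H"
  "(Inl a, Inr b) \<in> parcs (graph_join G H) \<longleftrightarrow> a \<in> pverts G \<and> b \<in> pverts H"
  "(Inr b, Inl a) \<in> parcs (graph_join G H) \<longleftrightarrow> a \<in> pverts G \<and> b \<in> pverts H"
  by (auto simp: graph_join_def)

lemma complete_graph_simps [simp]:
  "pverts (complete_graph r) = {..<r}"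
  "(a, b) \<in> parcs (complete_graph r) \<longleftrightarrow> a < r \<and> b < r \<and> a \<noteq> b"
  by (auto simp: complete_graph_def)

lemma pair_graph_complete_graph: "pair_graph (complete_graph r)"
  by (rule pair_graphI_complete[OF complete_digraph_complete_graph])

section \<open>Separations obtained from small vertex cuts\<close>

context graph
begin

text \<open>One side consists of everything reachable from a suitable vertex u after deleting S;
  being closed under adjacency there, it has no edge to the rest.\<close>

lemma vertex_cut_separation:
  assumes "vertex_cut G S"
  obtains A B where "verts G = S \<union> A \<union> B" "S \<inter> A = {}" "S \<inter> B = {}" "A \<inter> B = {}"
    "A \<noteq> {}" "B \<noteq> {}" "\<And>u. u \<in> A \<Longrightarrow> nbrs G u \<inter> B = {}"
proof -
  let ?W = "verts G - S"
  let ?H = "G \<restriction> ?W"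
  have S: "S \<subset> verts G" and nc: "\<not> Digraph_Component.connected ?H"
    using assms by (auto simp: vertex_cut_def)
  interpret H: wf_digraph ?H
    by (rule wf_digraphI_induced) (rule induced_induce, auto)
  \<comment> \<open>\<open>connected\<close> speaks of the symmetrised digraph, to which
    reachability in \<open>?H\<close> carries over; the strict inclusion of S makes
    \<open>?W\<close> nonempty.\<close>
  have "\<exists>u\<in>?W. \<exists>v\<in>?W. \<not> u \<rightarrow>\<^sup>*\<^bsub>?H\<^esub> v"
  proof (rule ccontr)
    assume "\<not> ?thesis"
    then have "Digraph_Component.connected ?H"
      unfolding Digraph_Component.connected_def using S H.reachable_mk_symmetricI
      by (intro strongly_connectedI) (auto simp: mk_symmetric_def)
    then show False using nc by blast
  qed
  then obtain u v where uv: "u \<in> ?W" "v \<in> ?W" "\<not> u \<rightarrow>\<^sup>*\<^bsub>?H\<^esub> v" by blast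
  define A where "A = {w \<in> ?W. u \<rightarrow>\<^sup>*\<^bsub>?H\<^esub> w}"
  have "u \<in> A" using uv H.reachable_refl by (simp add: A_def)
  moreover have "v \<in> ?W - A" using uv by (simp add: A_def)
  moreover have "nbrs G w \<inter> (?W - A) = {}" if w: "w \<in> A" for w
  proof (rule ccontr)
    assume "\<not> ?thesis"
    then obtain z where z: "(w, z) \<in> arcs_ends G" "z \<in> ?W" "z \<notin> A" by (auto simp: nbrs_def)
    then have "(w, z) \<in> arcs_ends ?H" using w by (auto simp: A_def arcs_ends_conv)
    then have "u \<rightarrow>\<^sup>*\<^bsub>?H\<^esub> z" using w H.reachable_adj_trans by (auto simp: A_def)
    then show False using z by (simp add: A_def)
  qed
  ultimately show ?thesis using S by (intro that[of A "?W - A"]) (auto simp: A_def)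
qed

lemma card_nbrs_le_side:
  assumes "verts G = S \<union> A \<union> B" "u \<in> A" "nbrs G u \<inter> B = {}"
  shows "card (nbrs G u) \<le> card A - 1 + card S"
proof -
  have fin: "finite A" "finite S" using assms(1) finite_verts by auto
  have "nbrs G u \<subseteq> (A - {u}) \<union> S"
    using assms nbrs_irrefl[of u] nbrs_subset[of u] by auto
  then have "card (nbrs G u) \<le> card ((A - {u}) \<union> S)"
    using fin by (intro card_mono) auto
  also have "\<dots> \<le> card (A - {u}) + card S" by (rule card_Un_le)
  finally show ?thesis using fin assms(2) by simp
qed

text \<open>A minimum cut C has at most s vertices, and the degree bound gives each side at least
  \<open>min_degree G + 1 - card C\<close> vertices. Moving s - |C| vertices from one side into the
  cut lowers that side's bound by just this amount; finally the sides are ordered by size.\<close>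

lemma small_connectivity_separation:
  assumes lt: "vertex_connectivity G \<le> s" and le: "s < min_degree G" and ne: "verts G \<noteq> {}"
  obtains S A B where "verts G = S \<union> A \<union> B" "S \<inter> A = {}" "S \<inter> B = {}" "A \<inter> B = {}"
    "card S = s" "min_degree G + 1 - s \<le> card A" "card A \<le> card B"
    "\<And>u. u \<in> A \<Longrightarrow> nbrs G u \<inter> B = {}"
proof -
  obtain u where u: "u \<in> verts G" using ne by blast
  have "nbrs G u \<subseteq> verts G - {u}" using nbrs_irrefl[of u] nbrs_subset[of u] by auto
  then have "card (nbrs G u) \<le> card (verts G) - 1"
    using card_mono[of "verts G - {u}" "nbrs G u"] u by simp
  then have "min_degree G \<le> card (verts G) - 1"
    using min_degree_le_card_nbrs[OF u] by simp
  \<comment> \<open>A complete graph would have connectivity \<open>card (verts G) - 1\<close>,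
    which is at least the minimum degree and so exceeds s.\<close>
  then have nc: "\<not> complete_digraph (card (verts G)) G"
    using lt le by (auto simp: vertex_connectivity_def)
  then have "vertex_connectivity G = Min {card S |S. vertex_cut G S}"
    by (simp add: vertex_connectivity_def)
  moreover have "Min {card S |S. vertex_cut G S} \<in> {card S |S. vertex_cut G S}"
    using vertex_cut_exists[OF nc] by (intro Min_in[OF finite_vertex_cuts]) auto
  ultimately have "vertex_connectivity G \<in> {card S |S. vertex_cut G S}" by simp
  then obtain C where C: "vertex_cut G C" "card C \<le> s" using lt by auto
  obtain A B0 where p: "verts G = C \<union> A \<union> B0" "C \<inter> A = {}" "C \<inter> B0 = {}" "A \<inter> B0 = {}"
    "A \<noteq> {}" "B0 \<noteq> {}" "\<And>u. u \<in> A \<Longrightarrow> nbrs G u \<inter> B0 = {}"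
    using vertex_cut_separation[OF C(1)] by metis
  have p8: "nbrs G u \<inter> A = {}" if "u \<in> B0" for u
    using p(7) nbrs_sym[of _ u] that by blast
  have fin: "finite C" "finite A" "finite B0" using p(1) finite_verts by auto
  have side: "min_degree G + 1 - card C \<le> card X"
    if X: "verts G = C \<union> X \<union> Y" "X \<noteq> {}" "\<And>u. u \<in> X \<Longrightarrow> nbrs G u \<inter> Y = {}" for X Y
  proof -
    obtain u where u: "u \<in> X" using X(2) by blast
    then have "min_degree G \<le> card (nbrs G u)" using X(1) min_degree_le_card_nbrs by blast
    also have "\<dots> \<le> card X - 1 + card C" using card_nbrs_le_side[OF X(1) u X(3)[OF u]] .
    finally show ?thesis
      using u X(1) finite_verts by (cases "card X") (auto simp: card_eq_0_iff)
  qed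
  have sA: "min_degree G + 1 - card C \<le> card A" using side[OF p(1,5)] p(7) by blast
  have sB: "min_degree G + 1 - card C \<le> card B0" using side[of B0 A] p(1,6) p8 by blast
  have "s - card C \<le> card B0" using sB le C by linarith
  then obtain D where D: "D \<subseteq> B0" "card D = s - card C" "finite D"
    using obtain_subset_with_card_n by metis
  let ?S = "C \<union> D" and ?B = "B0 - D"
  have q: "verts G = ?S \<union> A \<union> ?B" "?S \<inter> A = {}" "?S \<inter> ?B = {}" "A \<inter> ?B = {}"
    using p(1-4) D(1) by auto
  have "C \<inter> D = {}" using D(1) p(3) by blast
  then have cS: "card ?S = s"
    using D(2,3) C(2) fin(1) by (simp add: card_Un_disjoint)
  have cB: "min_degree G + 1 - s \<le> card ?B"
    using sB D C(2) fin(3) le by (simp add: card_Diff_subset)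
  have cA: "min_degree G + 1 - s \<le> card A" using sA C by linarith
  show ?thesis
  proof (cases "card A \<le> card ?B")
    case True
    then show ?thesis by (rule that[OF q cS cA]) (use p(7) in blast)
  next
    case False
    have q': "verts G = ?S \<union> ?B \<union> A" "?B \<inter> A = {}" using q(1,4) by auto
    show ?thesis
      by (rule that[OF q'(1) q(3,2) q'(2) cS cB]) (use False p8 in auto)
  qed
qed

section \<open>Recognising the exceptional graph\<close>

text \<open>Without parallel arcs an arc is determined by its ends, so sending it to the pair of
  images of its ends is injective and extends h to arcs.\<close>

lemma digraph_iso_with_projI:
  assumes h: "bij_betw h (verts G) (pverts H)" and H: "parcs H \<subseteq> pverts H \<times> pverts H"
    and arc: "\<And>u v. u \<in> verts G \<Longrightarrow> v \<in> verts G \<Longrightarrow> v \<in> nbrs G u \<longleftrightarrow> (h u, h v) \<in> parcs H"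
  shows "digraph_iso G (with_proj H)"
proof -
  define i where "i = \<lparr>iso_verts = h, iso_arcs = (\<lambda>e. (h (tail G e), h (head G e))),
    iso_head = snd, iso_tail = fst\<rparr>"
  have inj: "inj_on h (verts G)" and img: "h ` verts G = pverts H"
    using h by (auto simp: bij_betw_def)
  have "inj_on (\<lambda>e. (h (tail G e), h (head G e))) (arcs G)"
  proof (rule inj_onI)
    fix e f assume ef: "e \<in> arcs G" "f \<in> arcs G"
      "(h (tail G e), h (head G e)) = (h (tail G f), h (head G f))"
    then have "tail G e = tail G f" "head G e = head G f"
      using inj by (auto dest: inj_onD)
    then show "e = f" using ef no_multi_arcs by (auto simp: arc_to_ends_def)
  qed
  then have "digraph_isomorphism i"
    using inj wf_digraph by (simp add: digraph_isomorphism_def i_def)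
  moreover have "parcs H = (\<lambda>e. (h (tail G e), h (head G e))) ` arcs G"
  proof (intro Set.set_eqI iffI)
    fix z assume z: "z \<in> parcs H"
    then obtain u v where uv: "u \<in> verts G" "v \<in> verts G" "z = (h u, h v)"
      using H img by blast
    then have "(u, v) \<in> arcs_ends G" using z arc by (simp add: arcs_ends_iff_nbrs)
    then show "z \<in> (\<lambda>e. (h (tail G e), h (head G e))) ` arcs G"
      using uv by (auto simp: arcs_ends_conv)
  next
    fix z assume "z \<in> (\<lambda>e. (h (tail G e), h (head G e))) ` arcs G"
    then obtain e where e: "e \<in> arcs G" "z = (h (tail G e), h (head G e))" by blast
    then have "head G e \<in> nbrs G (tail G e)"
      by (auto simp: arcs_ends_conv simp flip: arcs_ends_iff_nbrs)
    then show "z \<in> parcs H" using e arc by auto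
  qed
  then have "with_proj H = app_iso i G"
    using img by (simp add: app_iso_def i_def with_proj_def)
  ultimately show ?thesis by (auto simp: digraph_iso_def)
qed

text \<open>Each block is numbered separately; the tags \<open>Inl\<close>,
  \<open>Inr (Inl _)\<close> and \<open>Inr (Inr _)\<close> follow the nesting of the join and the
  union.\<close>

lemma digraph_iso_join_complete:
  assumes V: "verts G = S \<union> A \<union> B" "S \<inter> A = {}" "S \<inter> B = {}" "A \<inter> B = {}"
    and adj: "\<And>u v. u \<in> verts G \<Longrightarrow> v \<in> verts G \<Longrightarrow>
      v \<in> nbrs G u \<longleftrightarrow> u \<noteq> v \<and> \<not> (u \<in> A \<and> v \<in> B) \<and> \<not> (u \<in> B \<and> v \<in> A)"
  shows "digraph_iso G (with_proj (graph_join (complete_graph (card S))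
    (disjoint_union (complete_graph (card A)) (complete_graph (card B)))))"
    (is "digraph_iso G (with_proj ?H)")
proof -
  have "finite S" "finite A" "finite B" using V(1) finite_verts by auto
  then obtain f g h where f: "bij_betw f S {..<card S}" and g: "bij_betw g A {..<card A}"
    and h: "bij_betw h B {..<card B}"
    by (metis finite_same_card_bij finite_lessThan card_lessThan)
  define k where "k u = (if u \<in> S then Inl (f u) else if u \<in> A then Inr (Inl (g u)) else Inr (Inr (h u)))" for u
  have kS: "k u = Inl (f u)" if "u \<in> S" for u using that by (simp add: k_def)
  have kA: "k u = Inr (Inl (g u))" if "u \<in> A" for u using that V by (auto simp: k_def)
  have kB: "k u = Inr (Inr (h u))" if "u \<in> B" for u using that V by (auto simp: k_def)
  note inj = f[THEN bij_betw_imp_inj_on, THEN inj_on_eq_iff]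
    g[THEN bij_betw_imp_inj_on, THEN inj_on_eq_iff] h[THEN bij_betw_imp_inj_on, THEN inj_on_eq_iff]
  have img: "f ` S = {..<card S}" "g ` A = {..<card A}" "h ` B = {..<card B}"
    using f g h by (auto simp: bij_betw_def)
  have mem: "u \<in> S \<Longrightarrow> f u < card S" "u \<in> A \<Longrightarrow> g u < card A" "u \<in> B \<Longrightarrow> h u < card B" for u
    using img by auto
  have "k ` S = Inl ` f ` S" "k ` A = Inr ` Inl ` g ` A" "k ` B = Inr ` Inr ` h ` B"
    unfolding image_image by (auto simp: kS kA kB intro!: image_cong)
  then have "k ` verts G = pverts ?H"
    unfolding V(1) image_Un img by auto
  moreover have "inj_on k (verts G)"
    unfolding inj_on_def V(1) by (auto simp: kS kA kB inj)
  ultimately have "bij_betw k (verts G) (pverts ?H)" by (simp add: bij_betw_def)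
  then show ?thesis
  proof (rule digraph_iso_with_projI)
    interpret H: pair_graph ?H
      by (intro pair_graph_graph_join pair_graph_disjoint_union pair_graph_complete_graph)
    show "parcs ?H \<subseteq> pverts ?H \<times> pverts ?H"
    proof (rule subrelI)
      fix a b assume ab: "(a, b) \<in> parcs ?H"
      show "(a, b) \<in> pverts ?H \<times> pverts ?H"
        using H.in_arcsD1[OF ab] H.in_arcsD2[OF ab] by (rule SigmaI)
    qed
    fix u v assume uv: "u \<in> verts G" "v \<in> verts G"
    have "(k u, k v) \<in> parcs ?H \<longleftrightarrow> u \<noteq> v \<and> \<not> (u \<in> A \<and> v \<in> B) \<and> \<not> (u \<in> B \<and> v \<in> A)"
    proof -
      have "u \<in> S \<or> u \<in> A \<or> u \<in> B" "v \<in> S \<or> v \<in> A \<or> v \<in> B" using uv V(1) by auto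
      then show ?thesis
        using V(2-4) by (elim disjE) (auto simp: kS kA kB inj mem)
    qed
    then show "v \<in> nbrs G u \<longleftrightarrow> (k u, k v) \<in> parcs ?H" using adj[OF uv] by simp
  qed
qed

end

section \<open>From the spectral bounds to the dichotomy\<close>

theorem theorem2p5:
  fixes G :: "('a, 'b) pre_digraph" and n k \<delta> \<kappa> :: nat
  assumes "graph G"
    and "Digraph_Component.connected G"
    and "card (verts G) = n"
    and "min_degree G = \<delta>"
    and "vertex_connectivity G = \<kappa>"
    and "\<delta> \<ge> k" and "k \<ge> 3"
    and "real n \<ge> 1 / 2 * (real \<delta> - real k + 2) * ((real k)\<^sup>2 - 2 * real k + 7)"
    and "graph_spectral_radius G \<ge> real n - real \<delta> + real k - 3"
  shows "\<kappa> \<ge> k \<or>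
    digraph_iso G (with_proj (graph_join (complete_graph (k - 1))
      (disjoint_union (complete_graph (\<delta> - k + 2)) (complete_graph (n - \<delta> - 1)))))"
proof (cases "\<kappa> \<ge> k")
  case False
  then have \<kappa>: "vertex_connectivity G \<le> k - 1" using assms(5) by simp
  interpret graph G by fact
  have ne: "verts G \<noteq> {}"
    using assms(2) by (simp add: Digraph_Component.connected_def strongly_connected_def mk_symmetric_def)
  define m where "m = \<delta> - k + 2"
  define N where "N = real n - real m"
  have m: "m \<ge> 2" "real m = real \<delta> - real k + 2" "\<delta> + 1 - (k - 1) = m" "m + (k - 1) = \<delta> + 1"
    using assms(6,7) by (auto simp: m_def)
  have "k - 1 < min_degree G" using assms(4,6,7) by simp
  from small_connectivity_separation[OF \<kappa> this ne, unfolded assms(4) m(3)]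
  obtain S A B where V: "verts G = S \<union> A \<union> B" "S \<inter> A = {}" "S \<inter> B = {}" "A \<inter> B = {}"
    and S: "card S = k - 1" and A: "m \<le> card A" "card A \<le> card B"
    and sep: "\<And>u. u \<in> A \<Longrightarrow> nbrs G u \<inter> B = {}"
    by metis
  have sep': "nbrs G u \<inter> A = {}" if "u \<in> B" for u
    using sep nbrs_sym[of _ u] that by blast
  have fin: "finite S" "finite A" "finite B" using V(1) finite_verts by auto
  have n: "n = card S + card A + card B"
    unfolding assms(3)[symmetric] V(1) using V fin by (simp add: card_Un_disjoint Int_Un_distrib2)
  have S2: "card S \<ge> 2" using S assms(7) by simp
  \<comment> \<open>Completing the square with |S| = k - 1; subtracting m from n then turns the 6
    into the 4 of the weight lemmas.\<close>
  have "(real k)\<^sup>2 - 2 * real k + 7 = (real (card S))\<^sup>2 + 6"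
    using S assms(7) by (simp add: of_nat_diff power2_eq_square algebra_simps)
  then have "real n \<ge> 1 / 2 * real m * ((real (card S))\<^sup>2 + 6)"
    using assms(8) by (simp only: m(2))
  then have N: "N \<ge> real m * ((real (card S))\<^sup>2 + 4) / 2"
    by (simp add: N_def algebra_simps add_divide_distrib)
  have ge: "\<not> graph_spectral_radius G < N - 1"
    using assms(9) m(2) by (simp add: N_def)
  have cA: "card A = m"
  proof (rule ccontr)
    assume "card A \<noteq> m"
    then have "real (card A) \<ge> real m + 1" using A(1) by simp
    then have "graph_spectral_radius G < N - 1"
      using spectral_radius_less_larger_side[OF V sep S2 _ _ A(2) _ N] m(1) by (simp add: N_def assms(3))
    then show False using ge by simp
  qed
  have NSB: "N = real (card S + card B)" using n cA by (simp add: N_def)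
  have W: "q \<in> nbrs G p" if "p \<in> S \<union> B" "q \<in> S \<union> B" "p \<noteq> q" for p q
    using spectral_radius_less_missing_edge[OF V sep S2 cA m(1) NSB N that] ge by blast
  have nA: "nbrs G u = S \<union> A - {u}" if u: "u \<in> A" for u
  proof (rule card_seteq)
    show "nbrs G u \<subseteq> S \<union> A - {u}"
      using sep[OF u] nbrs_irrefl[of u] nbrs_subset[of u] V(1) by auto
    \<comment> \<open>Exactly (k - 1) + m - 1 = \<delta> vertices are available, so the minimum
      degree forces all of them to be neighbours of u.\<close>
    have "card (S \<union> A - {u}) = \<delta>"
      using u fin V(2) S cA m(4) by (simp add: card_Un_disjoint)
    also have "\<delta> \<le> card (nbrs G u)"
      using min_degree_le_card_nbrs[of u] u V(1) assms(4) by auto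
    finally show "card (S \<union> A - {u}) \<le> card (nbrs G u)" .
  qed (use fin in auto)
  have "v \<in> nbrs G u \<longleftrightarrow> u \<noteq> v \<and> \<not> (u \<in> A \<and> v \<in> B) \<and> \<not> (u \<in> B \<and> v \<in> A)"
    if "u \<in> verts G" "v \<in> verts G" for u v
  proof (cases "u \<in> A \<or> v \<in> A")
    case True
    have "v \<in> nbrs G u \<longleftrightarrow> v \<in> S \<union> A - {u}" if "u \<in> A" using nA[OF that] by simp
    moreover have "v \<in> nbrs G u \<longleftrightarrow> u \<in> S \<union> A - {v}" if "v \<in> A"
      unfolding nA[OF that, symmetric] by (rule iffI; erule nbrs_sym)
    moreover have "u \<in> S \<or> u \<in> A \<or> u \<in> B" "v \<in> S \<or> v \<in> A \<or> v \<in> B"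
      using that V(1) by auto
    ultimately show ?thesis using True V(2-4) by blast
  next
    case False
    then show ?thesis using W[of u v] that V(1) nbrs_irrefl[of u] by auto
  qed
  from digraph_iso_join_complete[OF V this]
  have "digraph_iso G (with_proj (graph_join (complete_graph (card S))
      (disjoint_union (complete_graph (card A)) (complete_graph (card B)))))" by blast
  \<comment> \<open>S and A together have (k - 1) + m = \<delta> + 1 vertices.\<close>
  moreover have "card B = n - \<delta> - 1" using n S cA m(4) by simp
  ultimately show ?thesis
    using S cA by (simp add: m_def)
qed simp

end
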